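(* Let $M\ge 2$ be an integer and fix an integer $r\ge3$. Then there exists a non-unimodal pure $O$-sequence of codimension $r$ (i.e. with $h_1=r$) having exactly $M$ maxima.
   Context: A monomial order ideal is a finite nonempty set of monomials closed under taking divisors; it is pure if all its maximal monomials under divisibility have the same degree $e$. A pure $O$-sequence is the vector $(h_0,\dots,h_e)$ counting the monomials of each degree in a pure monomial order ideal; its codimension is $h_1$. A sequence is unimodal if $h_0\le\dots\le h_j\ge h_{j+1}\ge\dots\ge h_e$ for some $j$. A maximum (peak) of $(h_0,\dots,h_e)$ is a maximal run of equal consecutive entries $h_a=\dots=h_b$ such that either $a=0$ or $h_{a-1}<h_a$, and either $b=e$ or $h_b>h_{b+1}$. *)

theory Defs
  imports Complex_Main "HOL-Library.Multiset"
begin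

text \<open>
  A monomial is the finite multiset of its variables: divisibility is \<open>\<subseteq>#\<close> and the degree is
  \<open>size\<close> (the monomial encoding of \<open>HOL-Algebra.Indexed_Polynomials\<close>).
\<close>

definition monomial_order_ideal :: "'v multiset set \<Rightarrow> bool" where
  "monomial_order_ideal X \<longleftrightarrow>
     finite X \<and> X \<noteq> {} \<and> (\<forall>m\<in>X. \<forall>d. d \<subseteq># m \<longrightarrow> d \<in> X)"

definition maximal_monomials :: "'v multiset set \<Rightarrow> 'v multiset set" where
  "maximal_monomials X = {m \<in> X. \<forall>n\<in>X. m \<subseteq># n \<longrightarrow> n = m}"

definition pure_of_degree :: "'v multiset set \<Rightarrow> nat \<Rightarrow> bool" where
  "pure_of_degree X e \<longleftrightarrow> (\<forall>m\<in>maximal_monomials X. size m = e)"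

definition h_vector :: "'v multiset set \<Rightarrow> nat \<Rightarrow> nat list" where
  "h_vector X e = map (\<lambda>i. card {m \<in> X. size m = i}) [0..<Suc e]"

text \<open>
  An order ideal is finite, so it involves finitely many variables and indexing the variables by
  \<^typ>\<open>nat\<close> is no restriction.
\<close>

definition pure_O_sequence :: "nat list \<Rightarrow> bool" where
  "pure_O_sequence h \<longleftrightarrow>
     (\<exists>(X :: nat multiset set) e.
        monomial_order_ideal X \<and> pure_of_degree X e \<and> h = h_vector X e)"

text \<open>The entry \<open>h\<^sub>1\<close>, read as \<open>0\<close> for the sequence \<open>(1)\<close> with \<open>e = 0\<close>.\<close>

definition codimension :: "nat list \<Rightarrow> nat" where
  "codimension h = (if 1 < length h then h ! 1 else 0)"

definition unimodal :: "nat list \<Rightarrow> bool" where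
  "unimodal h \<longleftrightarrow>
     (\<exists>j < length h.
        (\<forall>i < j. h ! i \<le> h ! (i + 1)) \<and>
        (\<forall>i. j \<le> i \<and> i + 1 < length h \<longrightarrow> h ! i \<ge> h ! (i + 1)))"

text \<open>
  A maximum is represented by the end points \<open>(a, b)\<close> of its run. The two strict inequalities
  already make the run a maximal one.
\<close>

definition maxima :: "nat list \<Rightarrow> (nat \<times> nat) set" where
  "maxima h = {(a, b). a \<le> b \<and> b < length h \<and> (\<forall>i\<in>{a..b}. h ! i = h ! a) \<and>
     (a = 0 \<or> h ! (a - 1) < h ! a) \<and>
     (b = length h - 1 \<or> h ! b > h ! (b + 1))}"

end

theory Submission
  imports Defs
begin

text \<open>
  Truncating a pure order ideal above a given degree keeps it pure, and lengthening a sequence by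
  one entry creates at most one new maximum. Hence it suffices to find, in every codimension
  \<open>r \<ge> 3\<close>, pure \<open>O\<close>-sequences with arbitrarily many maxima. Adding the pure powers of \<open>r - 3\<close>
  further variables to the generators adds the constant \<open>r - 3\<close> in all positive degrees, so the
  oscillation has to come from three variables \<open>x, y, z\<close>.

  Take as generators all monomials of degree \<open>e\<close> with \<open>z\<close>-degree at most \<open>K\<close> (a strip), and for
  \<open>i = 0, \<dots>, m\<close> the monomials of degree \<open>e\<close> with \<open>z\<close>-degree \<open>K + B\<^sup>i\<close> whose \<open>x\<close>-degree is a multiple
  of \<open>B\<^sup>i\<close> (a comb). Count the divisors of degree \<open>e - j\<close> as \<open>j\<close> grows. A full strip of height \<open>c\<close>
  loses \<open>c + 1\<close> monomials per step. The teeth of the \<open>i\<close>-th comb have merged at \<open>j = 2 B\<^sup>i\<close>, which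
  has enlarged the strip to height \<open>K + B\<^sup>i\<close>: a peak. At \<open>j = 4 B\<^sup>i\<close> the coarser combs have only
  \<open>O(e / B\<^bsup>i+1\<^esup>)\<close> teeth with \<open>O(j\<^sup>2)\<close> divisors each, which cannot make up for the loss of about
  \<open>2 B\<^sup>i K\<close> monomials in the strip: a valley.
\<close>

section \<open>Maxima of sequences\<close>

lemma maximaD:
  assumes "(a, b) \<in> maxima h"
  shows "a \<le> b" and "b < length h" and "\<And>i. a \<le> i \<Longrightarrow> i \<le> b \<Longrightarrow> h ! i = h ! a"
    and "a = 0 \<or> h ! (a - 1) < h ! a" and "b = length h - 1 \<or> h ! (b + 1) < h ! b"
  using assms unfolding maxima_def mem_Collect_eq prod.case atLeastAtMost_iff Ball_def by blast+

text \<open>All sequences below are truncations of one function \<open>H\<close>; here the length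
  enters only through \<open>b < n\<close> and \<open>b = n - 1\<close>.\<close>

lemma maxima_map_iff:
  "(a, b) \<in> maxima (map H [0..<n]) \<longleftrightarrow> a \<le> b \<and> b < n \<and> (\<forall>i\<in>{a..b}. H a = H i) \<and>
     (a = 0 \<or> H (a - 1) < H a) \<and> (b = n - 1 \<or> H (b + 1) < H b)"
proof -
  have run: "(\<forall>i\<in>{a..b}. map H [0..<n] ! i = map H [0..<n] ! a) \<longleftrightarrow> (\<forall>i\<in>{a..b}. H a = H i)"
    if "a \<le> b" "b < n"
    using that by (intro ball_cong) auto
  show ?thesis
  proof (cases "a \<le> b \<and> b < n")
    case True
    then have "b = n - 1 \<or> b + 1 < n" by linarith
    with True show ?thesis
      unfolding maxima_def mem_Collect_eq prod.case by (subst run) auto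
  next
    case False
    then show ?thesis unfolding maxima_def mem_Collect_eq prod.case length_map length_upt
      by linarith
  qed
qed

section \<open>Lower bounds for the number of maxima\<close>

text \<open>Take the largest value on \<open>{v..w}\<close>, its first position and the run of it
  from there: both ends of the interval lie below that value, so the run stays strictly
  inside.\<close>

lemma maximum_between:
  fixes H :: "nat \<Rightarrow> nat"
  assumes "v < p" "p < w" "w < n" "H v < H p" "H w < H p"
  shows "\<exists>a b. (a, b) \<in> maxima (map H [0..<n]) \<and> v < a \<and> b < w"
proof -
  define m where "m = Max (H ` {v..w})"
  have le: "H i \<le> m" if "v \<le> i" "i \<le> w" for i
    unfolding m_def using that by (intro Max_ge) auto
  have "m \<in> H ` {v..w}" unfolding m_def using assms by (intro Max_in) auto
  then have ex: "\<exists>i. v \<le> i \<and> i \<le> w \<and> H i = m" by auto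
  define a where "a = (LEAST i. v \<le> i \<and> i \<le> w \<and> H i = m)"
  have a: "v \<le> a" "a \<le> w" "H a = m"
    using LeastI_ex[OF ex] unfolding a_def by auto
  have a_least: "H i \<noteq> m" if "v \<le> i" "i < a" for i
    using not_less_Least[of i "\<lambda>i. v \<le> i \<and> i \<le> w \<and> H i = m"] that a unfolding a_def by auto
  have "H p \<le> m" using le assms by simp
  with assms have Hv: "H v < m" and Hw: "H w < m" by auto
  then have "v \<noteq> a" "a \<noteq> w" using a by auto
  then have va: "v < a" and aw: "a < w" using a by auto
  define c where "c = (LEAST i. a < i \<and> H i \<noteq> m)"
  have ex': "\<exists>i. a < i \<and> H i \<noteq> m" using aw Hw by (metis less_irrefl)
  have c: "a < c" "H c \<noteq> m" using LeastI_ex[OF ex'] unfolding c_def by auto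
  have c_least: "H i = m" if "a \<le> i" "i < c" for i
    using not_less_Least[of i "\<lambda>i. a < i \<and> H i \<noteq> m"] that a(3) unfolding c_def
    by (cases "i = a") auto
  have cw: "c \<le> w" unfolding c_def using aw Hw by (intro Least_le) auto
  have "H (a - 1) < m"
    using le[of "a - 1"] a_least[of "a - 1"] va aw by (simp add: le_neq_implies_less)
  moreover have "H c < m" using le[of c] c va cw by simp
  ultimately have "(a, c - 1) \<in> maxima (map H [0..<n])"
    unfolding maxima_map_iff using c(1) cw assms(3) va a(3) c_least by auto
  then show ?thesis using va c cw by (intro exI[of _ a] exI[of _ "c - 1"]) auto
qed

lemma finite_maxima [simp]: "finite (maxima h)"
proof (rule finite_subset)
  show "maxima h \<subseteq> {..<length h} \<times> {..<length h}"
    using maximaD(1,2)[of _ _ h] by fastforce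
qed simp

text \<open>Each gap between \<open>v (Suc i)\<close> and \<open>v i\<close> contains a whole
  maximum, and the gaps are disjoint. The positions decrease in \<open>i\<close> because the
  application counts by codegree.\<close>

lemma card_maxima_ge:
  fixes H :: "nat \<Rightarrow> nat" and v p :: "nat \<Rightarrow> nat"
  assumes "\<And>i. i < m \<Longrightarrow> v (Suc i) < p i \<and> p i < v i \<and> H (v i) < H (p i) \<and> H (v (Suc i)) < H (p i)"
    and "v 0 < n"
  shows "m \<le> card (maxima (map H [0..<n]))"
proof -
  have anti: "v j \<le> v i" if "i \<le> j" "j \<le> m" for i j
    using that
  proof (induction j rule: dec_induct)
    case (step k)
    then show ?case using assms(1)[of k] by force
  qed simp
  have "\<exists>x. x \<in> maxima (map H [0..<n]) \<and> v (Suc i) < fst x \<and> snd x < v i" if i: "i < m" for i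
  proof -
    have "v i < n" using anti[of 0 i] i assms(2) by simp
    then obtain a b where "(a, b) \<in> maxima (map H [0..<n])" "v (Suc i) < a" "b < v i"
      using maximum_between[of "v (Suc i)" "p i" "v i" n H] assms(1)[OF i] by blast
    then show ?thesis by (intro exI[of _ "(a, b)"]) simp
  qed
  then obtain f where f: "\<And>i. i < m \<Longrightarrow>
      f i \<in> maxima (map H [0..<n]) \<and> v (Suc i) < fst (f i) \<and> snd (f i) < v i"
    by metis
  have le: "fst (f i) \<le> snd (f i)" if "i < m" for i
    using f[OF that] maximaD(1)[of "fst (f i)" "snd (f i)" "map H [0..<n]"] by simp
  have ne: "f i \<noteq> f j" if "i < j" "j < m" for i j
    using f[of i] f[of j] le[of j] anti[of "Suc i" j] that by auto
  have "inj_on f {..<m}"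
    using ne by (intro linorder_inj_onI) auto
  then have "card {..<m} \<le> card (maxima (map H [0..<n]))"
    using f by (intro card_inj_on_le) auto
  then show ?thesis by simp
qed

section \<open>Truncation to an exact number of maxima\<close>

text \<open>A maximum ending before \<open>n\<close> survives the removal of the last entry, and at
  most one maximum ends at \<open>n\<close> itself.\<close>

lemma card_maxima_Suc_le:
  "card (maxima (map H [0..<Suc n])) \<le> Suc (card (maxima (map H [0..<n])))"
proof -
  let ?A = "{x \<in> maxima (map H [0..<Suc n]). snd x = n}"
  have le: "fst y \<le> fst x" if x: "x \<in> ?A" and y: "y \<in> ?A" for x y
  proof (rule ccontr)
    obtain a c where xy: "x = (a, n)" "y = (c, n)" using x y by (cases x, cases y) auto
    assume "\<not> fst y \<le> fst x"
    then have "a < c" using xy by simp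
    have xm: "(a, n) \<in> maxima (map H [0..<Suc n])" and ym: "(c, n) \<in> maxima (map H [0..<Suc n])"
      using x y unfolding xy by simp_all
    \<comment> \<open>The later start \<open>c\<close> lies inside the run from \<open>a\<close>,
      against the strict ascent before \<open>c\<close>.\<close>
    have run: "H i = H a" if "a \<le> i" "i \<le> n" for i
      using xm that unfolding maxima_map_iff by (metis atLeastAtMost_iff)
    have "c \<le> n" "H (c - 1) < H c"
      using ym \<open>a < c\<close> unfolding maxima_map_iff by auto
    moreover have "a \<le> c - 1" "c - 1 \<le> n" using \<open>a < c\<close> \<open>c \<le> n\<close> by auto
    ultimately show False using run[of c] run[of "c - 1"] \<open>a < c\<close> by simp
  qed
  have "x = y" if "x \<in> ?A" "y \<in> ?A" for x y
    using le[OF that] le[OF that(2,1)] that by (simp add: prod_eq_iff)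
  moreover have "finite ?A" by simp
  ultimately have "card ?A \<le> 1" by (simp add: card_le_Suc0_iff_eq)
  moreover have "maxima (map H [0..<Suc n]) \<subseteq> maxima (map H [0..<n]) \<union> ?A"
  proof
    fix x assume x: "x \<in> maxima (map H [0..<Suc n])"
    show "x \<in> maxima (map H [0..<n]) \<union> ?A"
    proof (cases "snd x = n")
      case False
      obtain a b where ab: "x = (a, b)" by fastforce
      from x False have "x \<in> maxima (map H [0..<n])"
        unfolding ab maxima_map_iff by auto
      then show ?thesis by simp
    qed (use x in simp)
  qed
  then have "card (maxima (map H [0..<Suc n])) \<le> card (maxima (map H [0..<n]) \<union> ?A)"
    by (intro card_mono) auto
  ultimately show ?thesis
    using card_Un_le[of "maxima (map H [0..<n])" ?A] by linarith
qed

text \<open>A discrete intermediate value argument: the count starts at 0 for the empty sequence and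
  rises by at most one per entry.\<close>

lemma exact_card_maxima:
  assumes "M \<le> card (maxima (map H [0..<n]))" "M \<ge> 1"
  shows "\<exists>k\<le>n. card (maxima (map H [0..<k])) = M"
  using assms
proof (induction n)
  case 0
  then show ?case by (auto simp: maxima_def)
next
  case (Suc n)
  show ?case
  proof (cases "M \<le> card (maxima (map H [0..<n]))")
    case True
    then show ?thesis using Suc le_SucI by blast
  next
    case False
    then have "card (maxima (map H [0..<Suc n])) = M"
      using card_maxima_Suc_le[of H n] Suc.prems by linarith
    then show ?thesis by blast
  qed
qed

section \<open>Unimodality\<close>

text \<open>If a later maximum exists, the earlier one is followed by a strict descent and so ends
  at \<open>j\<close> or beyond; the strict ascent into the later one would then lie in the
  descending part.\<close>

lemma unimodal_imp_card_maxima_le_1: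
  assumes "unimodal h"
  shows "card (maxima h) \<le> 1"
proof -
  obtain j where up: "\<And>i. i < j \<Longrightarrow> h ! i \<le> h ! (i + 1)"
    and down: "\<And>i. j \<le> i \<Longrightarrow> i + 1 < length h \<Longrightarrow> h ! (i + 1) \<le> h ! i"
    using assms unfolding unimodal_def by auto
  have fst_le: "fst y \<le> fst x" if x: "x \<in> maxima h" and y: "y \<in> maxima h" for x y
  proof (rule ccontr)
    obtain a b c d where xy: "x = (a, b)" "y = (c, d)" by (metis surj_pair)
    assume "\<not> fst y \<le> fst x"
    then have ac: "a < c" using xy by simp
    note x = maximaD[OF x[unfolded xy]] and y = maximaD[OF y[unfolded xy]]
    have c: "h ! (c - 1) < h ! c" using y(4) ac by simp
    have bc: "b < c" using x(3)[of c] x(3)[of "c - 1"] c ac by force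
    then have "h ! b > h ! (b + 1)" using x(5) y(1,2) by auto
    then have "j \<le> b" using up[of b] by force
    then have "j \<le> c - 1" "c - 1 + 1 = c" "c < length h" using bc y(1,2) by auto
    then show False using down[of "c - 1"] c by simp
  qed
  have snd_le: "snd y \<le> snd x" if x: "x \<in> maxima h" and y: "y \<in> maxima h" and eq: "fst x = fst y" for x y
  proof (rule ccontr)
    obtain a b d where xy: "x = (a, b)" "y = (a, d)" using eq by (metis surjective_pairing)
    assume "\<not> snd y \<le> snd x"
    then have bd: "b < d" using xy by simp
    note x = maximaD[OF x[unfolded xy]] and y = maximaD[OF y[unfolded xy]]
    have "h ! b = h ! a" "h ! (b + 1) = h ! a"
      using y(3)[of b] y(3)[of "b + 1"] bd x(1) by linarith+
    then show False using x(5) y(2) bd by linarith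
  qed
  have "x = y" if "x \<in> maxima h" "y \<in> maxima h" for x y
    using fst_le[OF that] fst_le[OF that(2,1)] snd_le[OF that] snd_le[OF that(2,1)]
    by (simp add: prod_eq_iff)
  then show ?thesis by (simp add: card_le_Suc0_iff_eq)
qed

section \<open>Order ideals and monomials in three variables\<close>

definition divisors_of :: "'v multiset set \<Rightarrow> 'v multiset set" where
  "divisors_of G = {m. \<exists>g\<in>G. m \<subseteq># g}"

lemma finite_divisors_of:
  fixes G :: "'v multiset set"
  assumes "finite G"
  shows "finite (divisors_of G)"
proof -
  have "finite {m. m \<subseteq># g}" for g :: "'v multiset"
  proof (rule finite_subset)
    show "{m. m \<subseteq># g} \<subseteq> (\<Union>n\<le>size g. multisets_of_size (set_mset g) n)"
      by (auto simp: multisets_of_size_def size_mset_mono dest: mset_subset_eqD)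
  qed auto
  moreover have "divisors_of G = (\<Union>g\<in>G. {m. m \<subseteq># g})"
    unfolding divisors_of_def by auto
  ultimately show ?thesis using assms by simp
qed

text \<open>A divisor \<open>m\<close> of \<open>g\<close> of degree below \<open>n\<close> is a
  proper one, so it can be multiplied by a variable of \<open>g - m\<close> without leaving the
  truncated ideal; hence maximal monomials have degree \<open>n\<close>.\<close>

lemma pure_O_sequence_truncated:
  fixes G :: "nat multiset set"
  assumes "finite G" "G \<noteq> {}" "\<And>g. g \<in> G \<Longrightarrow> size g = e" "n \<le> e"
  shows "pure_O_sequence (map (\<lambda>i. card {m \<in> divisors_of G. size m = i}) [0..<Suc n])"
proof -
  define X where "X = {m \<in> divisors_of G. size m \<le> n}"
  have "monomial_order_ideal X"
    unfolding monomial_order_ideal_def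
  proof (intro conjI ballI allI impI)
    show "finite X" unfolding X_def using finite_divisors_of[OF assms(1)] by simp
    have "{#} \<in> X" using assms(2) unfolding X_def divisors_of_def by auto
    then show "X \<noteq> {}" by blast
    show "d \<in> X" if "m \<in> X" "d \<subseteq># m" for m d
      using that size_mset_mono[of d m] unfolding X_def divisors_of_def
      by (auto intro: subset_mset.order_trans)
  qed
  moreover have "pure_of_degree X n"
    unfolding pure_of_degree_def
  proof
    fix m assume m: "m \<in> maximal_monomials X"
    then obtain g where g: "g \<in> G" "m \<subseteq># g" and n: "size m \<le> n"
      unfolding maximal_monomials_def X_def divisors_of_def by auto
    show "size m = n"
    proof (rule ccontr)
      assume "size m \<noteq> n"
      with n have lt: "size m < n" by simp
      then have "m \<noteq> g" using assms(3)[OF g(1)] assms(4) by auto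
      with g(2) have "g - m \<noteq> {#}" by (metis Diff_eq_empty_iff_mset subset_mset.antisym)
      then obtain x where "x \<in># g - m" by blast
      then have "{#x#} \<subseteq># g - m" by simp
      then have "m + {#x#} \<subseteq># g"
        using g(2) by (metis subset_mset.add_diff_inverse subset_mset.add_left_mono)
      then have "m + {#x#} \<in> X"
        using g(1) lt unfolding X_def divisors_of_def by auto
      then show False using m unfolding maximal_monomials_def by auto
    qed
  qed
  moreover have "{m \<in> X. size m = i} = {m \<in> divisors_of G. size m = i}" if "i \<le> n" for i
    using that unfolding X_def by auto
  then have "map (\<lambda>i. card {m \<in> divisors_of G. size m = i}) [0..<Suc n] = h_vector X n"
    unfolding h_vector_def by (intro map_cong) auto
  ultimately show ?thesis unfolding pure_O_sequence_def by blast
qed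

section \<open>Divisibility of monomials in three variables\<close>

text \<open>The monomial \<open>x\<^sup>p y\<^sup>q z\<^sup>l\<close>, where \<open>x, y, z\<close> are the variables 0, 1, 2.\<close>

definition mono3 :: "nat \<Rightarrow> nat \<Rightarrow> nat \<Rightarrow> nat multiset" where
  "mono3 p q l = replicate_mset p 0 + replicate_mset q 1 + replicate_mset l 2"

lemma size_mono3 [simp]: "size (mono3 p q l) = p + q + l"
  by (simp add: mono3_def)

lemma count_mono3:
  "count (mono3 p q l) k = (if k = 0 then p else if k = 1 then q else if k = 2 then l else 0)"
  by (simp add: mono3_def)

lemma mono3_eq_iff [simp]: "mono3 p q l = mono3 p' q' l' \<longleftrightarrow> p = p' \<and> q = q' \<and> l = l'"
proof
  assume eq: "mono3 p q l = mono3 p' q' l'"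
  show "p = p' \<and> q = q' \<and> l = l'"
    using arg_cong[OF eq, of "\<lambda>m. count m 0"] arg_cong[OF eq, of "\<lambda>m. count m 1"]
      arg_cong[OF eq, of "\<lambda>m. count m 2"]
    by (simp add: count_mono3)
qed simp

lemma mono3_subseteq_iff [simp]:
  "mono3 p q l \<subseteq># mono3 p' q' l' \<longleftrightarrow> p \<le> p' \<and> q \<le> q' \<and> l \<le> l'"
proof
  assume "mono3 p q l \<subseteq># mono3 p' q' l'"
  then have "count (mono3 p q l) k \<le> count (mono3 p' q' l') k" for k
    by (simp add: mset_subset_eq_count)
  from this[of 0] this[of 1] this[of 2] show "p \<le> p' \<and> q \<le> q' \<and> l \<le> l'"
    by (simp add: count_mono3)
qed (auto intro!: mset_subset_eqI simp: count_mono3)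

lemma subseteq_mono3E:
  assumes "m \<subseteq># mono3 p' q' l'"
  obtains p q l where "m = mono3 p q l" "p \<le> p'" "q \<le> q'" "l \<le> l'"
proof -
  have le: "count m k \<le> count (mono3 p' q' l') k" for k
    using assms by (simp add: mset_subset_eq_count)
  have "m = mono3 (count m 0) (count m 1) (count m 2)"
  proof (rule multiset_eqI)
    show "count m k = count (mono3 (count m 0) (count m 1) (count m 2)) k" for k
      using le[of k] by (simp add: count_mono3 split: if_splits)
  qed
  then show ?thesis
    using that le[of 0] le[of 1] le[of 2] by (simp add: count_mono3)
qed

lemma subseteq_replicate_msetE:
  assumes "m \<subseteq># replicate_mset n k"
  obtains "m = replicate_mset (size m) k"
proof -
  have "set_mset m \<subseteq> {k}" using set_mset_mono[OF assms] by (auto split: if_splits)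
  then have "m = replicate_mset (size m) k"
    by (metis set_mset_subset_singletonD)
  then show ?thesis using that by blast
qed

text \<open>A divisor of codegree \<open>v\<close> is determined by the amounts
  \<open>a, b \<le> v\<close> removed from the first two exponents. Pairs with
  \<open>a + b > v\<close> may give other monomials, which is harmless for an upper bound.\<close>

lemma card_divisors_mono3_le:
  "card {m. m \<subseteq># mono3 P Q L \<and> size m + v = P + Q + L} \<le> (v + 1)\<^sup>2"
    (is "card ?D \<le> _")
proof -
  let ?f = "\<lambda>(a, b). mono3 (P - a) (Q - b) (L - (v - a - b))"
  have "?D \<subseteq> ?f ` ({..v} \<times> {..v})"
  proof
    fix m assume m: "m \<in> ?D"
    then obtain p q l where eq: "m = mono3 p q l" and "p \<le> P" "q \<le> Q" "l \<le> L"
      by (auto elim: subseteq_mono3E)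
    moreover have "p + q + l + v = P + Q + L" using m eq by simp
    ultimately have "m = ?f (P - p, Q - q)" "P - p \<le> v" "Q - q \<le> v" by auto
    then show "m \<in> ?f ` ({..v} \<times> {..v})" by blast
  qed
  then have "card ?D \<le> card (?f ` ({..v} \<times> {..v}))" by (intro card_mono) auto
  also have "\<dots> \<le> card ({..v} \<times> {..v})" by (intro card_image_le) auto
  finally show ?thesis by (simp add: power2_eq_square)
qed

section \<open>Counting the monomials of a strip\<close>

definition low_z :: "nat \<Rightarrow> nat \<Rightarrow> nat multiset set" where
  "low_z c d = {mono3 p q l | p q l. p + q + l = d \<and> l \<le> c}"

lemma low_z_eq_image:
  assumes "c \<le> d"
  shows "low_z c d = (\<lambda>(l, p). mono3 p (d - l - p) l) ` (SIGMA l:{..c}. {..d - l})"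
proof
  show "low_z c d \<subseteq> (\<lambda>(l, p). mono3 p (d - l - p) l) ` (SIGMA l:{..c}. {..d - l})"
    by (auto simp: low_z_def image_iff)
  show "(\<lambda>(l, p). mono3 p (d - l - p) l) ` (SIGMA l:{..c}. {..d - l}) \<subseteq> low_z c d"
    using assms by (auto simp: low_z_def)
qed

lemma finite_low_z: "finite (low_z c d)"
proof -
  have "low_z c d \<subseteq> (\<lambda>(p, q, l). mono3 p q l) ` ({..d} \<times> {..d} \<times> {..d})"
    by (auto simp: low_z_def image_iff)
  then show ?thesis by (rule finite_subset) simp
qed

lemma card_low_z:
  assumes "c \<le> d"
  shows "card (low_z c d) = (\<Sum>l\<le>c. d - l + 1)"
proof -
  have "inj_on (\<lambda>(l, p). mono3 p (d - l - p) l) (SIGMA l:{..c}. {..d - l})"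
    by (auto simp: inj_on_def)
  then have "card (low_z c d) = card (SIGMA l:{..c}. {..d - l})"
    unfolding low_z_eq_image[OF assms] by (rule card_image)
  then show ?thesis by simp
qed

text \<open>Each of the \<open>c + 1\<close> rows of constant z-degree grows by one monomial per
  degree.\<close>

lemma card_low_z_add:
  assumes "c \<le> d"
  shows "card (low_z c (d + k)) = card (low_z c d) + (c + 1) * k"
proof -
  have "(\<Sum>l\<le>c. d + k - l + 1) = (\<Sum>l\<le>c. (d - l + 1) + k)"
    using assms by (intro sum.cong) auto
  also have "\<dots> = (\<Sum>l\<le>c. d - l + 1) + (c + 1) * k"
    unfolding sum.distrib by simp
  finally show ?thesis using assms by (simp add: card_low_z)
qed

text \<open>Each new row \<open>l\<close> with \<open>c < l \<le> c'\<close> has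
  \<open>d - l + 1 \<ge> d - c'\<close> monomials.\<close>

lemma card_low_z_mono:
  assumes "c \<le> c'" "c' \<le> d"
  shows "card (low_z c d) + (c' - c) * (d - c') \<le> card (low_z c' d)"
proof -
  have "(c' - c) * (d - c') = (\<Sum>l\<in>{c<..c'}. d - c')" by simp
  also have "\<dots> \<le> (\<Sum>l\<in>{c<..c'}. d - l + 1)"
    by (intro sum_mono) auto
  finally have "card (low_z c d) + (c' - c) * (d - c')
      \<le> (\<Sum>l\<le>c. d - l + 1) + (\<Sum>l\<in>{c<..c'}. d - l + 1)"
    using assms by (simp add: card_low_z)
  also have "\<dots> = (\<Sum>l\<in>{..c} \<union> {c<..c'}. d - l + 1)"
    by (intro sum.union_disjoint[symmetric]) auto
  also have "{..c} \<union> {c<..c'} = {..c'}" using assms by auto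
  finally show ?thesis using assms by (simp add: card_low_z)
qed

section \<open>The strip and the combs\<close>

text \<open>
  All generators have degree \<open>e = socle_degree m\<close>. The ratios 1000 and 8 are merely large enough
  for the comparisons \<open>hilbert_peak_gt_valley\<close> and \<open>hilbert_next_peak_gt_valley\<close>.
\<close>

definition strip_height :: "nat \<Rightarrow> nat" where
  "strip_height m = 1000 ^ (m + 1)"

definition socle_degree :: "nat \<Rightarrow> nat" where
  "socle_degree m = 8 * strip_height m"

definition comb_height :: "nat \<Rightarrow> nat \<Rightarrow> nat" where
  "comb_height m i = strip_height m + 1000 ^ i"

text \<open>The y-exponent fills the degree up to \<open>socle_degree m\<close>; the bound on
  \<open>u\<close> in \<open>comb\<close> keeps its subtraction from truncating.\<close>

definition tooth :: "nat \<Rightarrow> nat \<Rightarrow> nat \<Rightarrow> nat multiset" where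
  "tooth m i u =
     mono3 (u * 1000 ^ i) (socle_degree m - comb_height m i - u * 1000 ^ i) (comb_height m i)"

definition comb :: "nat \<Rightarrow> nat \<Rightarrow> nat multiset set" where
  "comb m i = tooth m i ` {u. u * 1000 ^ i \<le> socle_degree m - comb_height m i}"

definition pure_powers :: "nat \<Rightarrow> nat \<Rightarrow> nat multiset set" where
  "pure_powers r d = replicate_mset d ` {3..<r}"

definition generators :: "nat \<Rightarrow> nat \<Rightarrow> nat multiset set" where
  "generators m r =
     low_z (strip_height m) (socle_degree m) \<union> (\<Union>i\<le>m. comb m i) \<union> pure_powers r (socle_degree m)"

definition hilbert :: "nat \<Rightarrow> nat \<Rightarrow> nat \<Rightarrow> nat" where
  "hilbert m r d = card {x \<in> divisors_of (generators m r). size x = d}"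

section \<open>Number and degree of the generators\<close>

lemma power_le_strip_height: "i \<le> m \<Longrightarrow> 1000 * 1000 ^ i \<le> strip_height m"
  using power_increasing[of "i + 1" "m + 1" "1000::nat"] by (simp add: strip_height_def)

lemma comb_height_le:
  assumes "i \<le> m"
  shows "comb_height m i \<le> socle_degree m"
  using power_le_strip_height[OF assms] by (simp add: comb_height_def socle_degree_def)

lemma comb_index_subset:
  assumes "i \<le> m"
  shows "{u. u * 1000 ^ i \<le> socle_degree m - comb_height m i} \<subseteq> {..<8 * 1000 ^ (m + 1 - i)}"
proof
  fix u assume u: "u \<in> {u. u * 1000 ^ i \<le> socle_degree m - comb_height m i}"
  have "strip_height m > 0" by (simp add: strip_height_def)
  then have "u * 1000 ^ i < 8 * strip_height m"
    using u by (simp add: socle_degree_def comb_height_def)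
  also have "strip_height m = 1000 ^ (m + 1 - i) * 1000 ^ i"
    using assms by (simp add: strip_height_def flip: power_add)
  finally have "u * 1000 ^ i < (8 * 1000 ^ (m + 1 - i)) * 1000 ^ i" by simp
  then show "u \<in> {..<8 * 1000 ^ (m + 1 - i)}"
    by (metis lessThan_iff mult_less_cancel2)
qed

lemma finite_comb: "i \<le> m \<Longrightarrow> finite (comb m i)"
  unfolding comb_def using comb_index_subset by (blast intro: finite_subset)

text \<open>The x-exponents are multiples of \<open>1000 ^ i\<close> below
  \<open>8 * strip_height m\<close>, so the bound drops by a factor 1000 per level.\<close>

lemma card_comb_le:
  assumes "i \<le> m"
  shows "card (comb m i) \<le> 8 * 1000 ^ (m + 1 - i)"
proof -
  let ?U = "{u. u * 1000 ^ i \<le> socle_degree m - comb_height m i}"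
  have fin: "finite ?U" using comb_index_subset[OF assms] by (blast intro: finite_subset)
  then have "card (comb m i) \<le> card ?U"
    unfolding comb_def by (rule card_image_le)
  also have "\<dots> \<le> card {..<8 * 1000 ^ (m + 1 - i) :: nat}"
    using comb_index_subset[OF assms] by (intro card_mono) auto
  finally show ?thesis by simp
qed

lemma finite_generators: "finite (generators m r)"
  unfolding generators_def pure_powers_def by (auto simp: finite_low_z finite_comb)

lemma size_generators:
  assumes "g \<in> generators m r"
  shows "size g = socle_degree m"
proof -
  consider "g \<in> low_z (strip_height m) (socle_degree m)" | "g \<in> pure_powers r (socle_degree m)"
    | i where "i \<le> m" "g \<in> comb m i"
    using assms unfolding generators_def by blast
  then show ?thesis
  proof cases
    case 3
    then show ?thesis using comb_height_le[OF 3(1)] unfolding comb_def tooth_def by auto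
  qed (auto simp: low_z_def pure_powers_def)
qed

lemma card_pure_powers: "d > 0 \<Longrightarrow> card (pure_powers r d) = r - 3"
  unfolding pure_powers_def by (subst card_image) (auto simp: inj_on_def replicate_mset_eq_iff)

lemma low_z_Int_pure_powers:
  assumes "d > 0"
  shows "low_z c d \<inter> pure_powers r d = {}"
proof -
  have "mono3 p q l \<noteq> replicate_mset d k" if "k \<ge> 3" for p q l k
  proof
    assume "mono3 p q l = replicate_mset d k"
    then have "count (mono3 p q l) k = count (replicate_mset d k) k" by simp
    then show False using that assms by (simp add: count_mono3)
  qed
  then show ?thesis unfolding low_z_def pure_powers_def by fastforce
qed

text \<open>In degree 0 every pure power is the monomial 1, which also lies in the strip; hence
  \<open>d > 0\<close>.\<close>

lemma card_low_z_Un_pure_powers: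
  assumes "d > 0"
  shows "card (low_z c d \<union> pure_powers r d) = card (low_z c d) + (r - 3)"
  using low_z_Int_pure_powers[OF assms] card_pure_powers[OF assms]
  by (subst card_Un_disjoint) (auto simp: finite_low_z pure_powers_def)

section \<open>Lower bound for the Hilbert function\<close>

text \<open>Inside the original strip, raise the y-exponent by \<open>j\<close>. Above it, rounding
  the x-exponent up to a tooth and raising the z-exponent to the comb each cost less than
  \<open>1000 ^ i\<close>; the codegree pays for both.\<close>

lemma low_z_subset_divisors:
  assumes "i \<le> m" "2 * 1000 ^ i \<le> j" "j \<le> socle_degree m"
  shows "low_z (comb_height m i) (socle_degree m - j) \<subseteq> divisors_of (generators m r)"
proof
  fix x assume "x \<in> low_z (comb_height m i) (socle_degree m - j)"
  then obtain p q l where x: "x = mono3 p q l" and deg: "p + q + l + j = socle_degree m"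
    and l: "l \<le> comb_height m i"
    using assms(3) unfolding low_z_def by auto
  show "x \<in> divisors_of (generators m r)"
  proof (cases "l \<le> strip_height m")
    case True
    then have "mono3 p (q + j) l \<in> generators m r"
      using deg unfolding generators_def low_z_def by auto
    moreover have "x \<subseteq># mono3 p (q + j) l" by (simp add: x)
    ultimately show ?thesis unfolding divisors_of_def by blast
  next
    case False
    define D :: nat where "D = 1000 ^ i"
    \<comment> \<open>The ceiling of \<open>p / D\<close>: the first tooth at or beyond
      \<open>p\<close>.\<close>
    define u where "u = (p + D - 1) div D"
    have D: "D > 0" by (simp add: D_def)
    have "(p + D - 1) div D * D + (p + D - 1) mod D = p + D - 1" by (rule div_mult_mod_eq)
    moreover have "(p + D - 1) mod D < D" using D by simp
    ultimately have u: "p \<le> u * D" "u * D < p + D"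
      using D unfolding u_def by linarith+
    have ht: "comb_height m i = strip_height m + D" by (simp add: comb_height_def D_def)
    have j: "2 * D \<le> j" using assms(2) by (simp add: D_def)
    have fit: "q + u * D + comb_height m i \<le> socle_degree m"
      using u(2) ht j False deg by linarith
    have "tooth m i u \<in> comb m i" unfolding comb_def using fit by (auto simp: D_def)
    then have "tooth m i u \<in> generators m r" unfolding generators_def using assms(1) by blast
    moreover have "x \<subseteq># tooth m i u" using u(1) fit l by (simp add: x D_def tooth_def)
    ultimately show ?thesis unfolding divisors_of_def by blast
  qed
qed

lemma pure_powers_subset_divisors:
  assumes "d \<le> socle_degree m"
  shows "pure_powers r d \<subseteq> divisors_of (generators m r)"
proof
  fix x assume "x \<in> pure_powers r d"
  then obtain k where k: "x = replicate_mset d k" "k \<in> {3..<r}"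
    unfolding pure_powers_def by blast
  have "replicate_mset (socle_degree m) k \<in> generators m r"
    using k(2) unfolding generators_def pure_powers_def by blast
  moreover have "x \<subseteq># replicate_mset (socle_degree m) k"
    using assms unfolding k(1) by (intro mset_subset_eqI) simp
  ultimately show "x \<in> divisors_of (generators m r)" unfolding divisors_of_def by blast
qed

text \<open>
  In codegree at least \<open>2 * 1000 ^ i\<close> the teeth of the \<open>i\<close>-th comb have merged, so every monomial
  of \<open>z\<close>-degree at most \<open>comb_height m i\<close> is present.
\<close>

lemma hilbert_ge:
  assumes "i \<le> m" "2 * 1000 ^ i \<le> j" "j < socle_degree m"
  shows "card (low_z (comb_height m i) (socle_degree m - j)) + (r - 3)
    \<le> hilbert m r (socle_degree m - j)"
proof -
  let ?d = "socle_degree m - j"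
  have "low_z (comb_height m i) ?d \<union> pure_powers r ?d
      \<subseteq> {x \<in> divisors_of (generators m r). size x = ?d}"
    using low_z_subset_divisors[of i m j r] pure_powers_subset_divisors[of ?d m r] assms
    by (auto simp: low_z_def pure_powers_def)
  then have "card (low_z (comb_height m i) ?d \<union> pure_powers r ?d) \<le> hilbert m r ?d"
    unfolding hilbert_def using finite_divisors_of[OF finite_generators]
    by (intro card_mono) auto
  then show ?thesis using assms(3) by (simp add: card_low_z_Un_pure_powers)
qed

section \<open>Upper bound for the Hilbert function\<close>

text \<open>A geometric sum with leading term \<open>1000 ^ (m - i)\<close>; the factor 2 absorbs
  the tail.\<close>

lemma sum_comb_sizes_le:
  assumes "i \<le> m"
  shows "(\<Sum>k\<in>{i<..m}. (1000::nat) ^ (m + 1 - k)) \<le> 2 * 1000 ^ (m - i)"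
  using assms
proof (induction i rule: inc_induct)
  case (step i)
  have "{i<..m} = insert (Suc i) {Suc i<..m}" using step by auto
  moreover have "(1000::nat) ^ (m - i) = 1000 * 1000 ^ (m - Suc i)"
    using step by (metis Suc_diff_Suc power_Suc)
  ultimately show ?case using step by simp
qed simp

text \<open>Generators from the strip and from combs \<open>k \<le> i\<close> have z-degree at most
  \<open>comb_height m i\<close>, and so do their divisors. Only the coarser combs can reach
  higher.\<close>

lemma divisors_subset:
  assumes "i \<le> m" "v \<le> socle_degree m"
  shows "{x \<in> divisors_of (generators m r). size x = socle_degree m - v} \<subseteq>
    (low_z (comb_height m i) (socle_degree m - v) \<union> pure_powers r (socle_degree m - v)) \<union>
    (\<Union>k\<in>{i<..m}. \<Union>g\<in>comb m k. {x. x \<subseteq># g \<and> size x + v = socle_degree m})"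
    (is "?X \<subseteq> ?L \<union> ?P \<union> ?C")
proof
  fix x assume "x \<in> ?X"
  then obtain g where g: "g \<in> generators m r" "x \<subseteq># g" and size: "size x = socle_degree m - v"
    unfolding divisors_of_def by auto
  have low: "x \<in> ?L" if "g = mono3 p q l" "l \<le> comb_height m i" for p q l
    using g(2) size that by (auto elim!: subseteq_mono3E simp: low_z_def)
  from g(1) consider "g \<in> low_z (strip_height m) (socle_degree m)"
    | k where "k \<le> m" "g \<in> comb m k"
    | "g \<in> pure_powers r (socle_degree m)"
    unfolding generators_def by blast
  then show "x \<in> ?L \<union> ?P \<union> ?C"
  proof cases
    case 1
    then show ?thesis using low unfolding low_z_def comb_height_def by auto
  next
    case 2
    show ?thesis
    proof (cases "k \<le> i")
      case True
      then have "comb_height m k \<le> comb_height m i" by (simp add: comb_height_def)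
      then show ?thesis using low 2(2) unfolding comb_def tooth_def by blast
    next
      case False
      then have "k \<in> {i<..m}" using 2(1) by simp
      moreover have "size x + v = socle_degree m" using size assms(2) by simp
      ultimately show ?thesis using 2(2) g(2) by blast
    qed
  next
    case 3
    then show ?thesis
      using g(2) size unfolding pure_powers_def by (auto elim!: subseteq_replicate_msetE)
  qed
qed

text \<open>
  Combs finer than the \<open>i\<close>-th one stay below its height, and each tooth of a coarser comb has at
  most \<open>(v + 1)\<^sup>2\<close> divisors of codegree \<open>v\<close>.
\<close>

lemma hilbert_le:
  assumes "i \<le> m" "v < socle_degree m"
  shows "hilbert m r (socle_degree m - v)
    \<le> card (low_z (comb_height m i) (socle_degree m - v)) + (r - 3)
      + 16 * 1000 ^ (m - i) * (v + 1)\<^sup>2"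
proof -
  let ?d = "socle_degree m - v"
  let ?D = "\<lambda>g. {x :: nat multiset. x \<subseteq># g \<and> size x + v = socle_degree m}"
  let ?C = "\<Union>k\<in>{i<..m}. \<Union>g\<in>comb m k. ?D g"
  have finD: "finite (?D g)" for g
    by (rule finite_subset[OF _ finite_divisors_of[of "{g}"]]) (auto simp: divisors_of_def)
  have "card (?D g) \<le> (v + 1)\<^sup>2" if "g \<in> comb m k" "k \<le> m" for g k
  proof -
    from that obtain P Q L where g: "g = mono3 P Q L" unfolding comb_def tooth_def by blast
    have "g \<in> generators m r" using that unfolding generators_def by blast
    then have "P + Q + L = socle_degree m" using size_generators[of g] g by simp
    then show ?thesis using card_divisors_mono3_le[of P Q L v] g by simp
  qed
  then have "card (\<Union>g\<in>comb m k. ?D g) \<le> card (comb m k) * (v + 1)\<^sup>2" if "k \<le> m" for k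
    using card_UN_le[OF finite_comb[OF that], of ?D] that
      sum_bounded_above[of "comb m k" "\<lambda>g. card (?D g)" "(v + 1)\<^sup>2"]
    by fastforce
  then have row: "card (\<Union>g\<in>comb m k. ?D g) \<le> 8 * 1000 ^ (m + 1 - k) * (v + 1)\<^sup>2" if "k \<le> m" for k
    using card_comb_le[OF that] that by (meson le_trans mult_le_mono1)
  have "card ?C \<le> (\<Sum>k\<in>{i<..m}. card (\<Union>g\<in>comb m k. ?D g))"
    by (rule card_UN_le) simp
  also have "\<dots> \<le> (\<Sum>k\<in>{i<..m}. 8 * 1000 ^ (m + 1 - k) * (v + 1)\<^sup>2)"
    using row by (intro sum_mono) auto
  also have "\<dots> = 8 * (\<Sum>k\<in>{i<..m}. 1000 ^ (m + 1 - k)) * (v + 1)\<^sup>2"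
    by (simp only: sum_distrib_left sum_distrib_right)
  also have "\<dots> \<le> 8 * (2 * 1000 ^ (m - i)) * (v + 1)\<^sup>2"
    using sum_comb_sizes_le[OF assms(1)] by (intro mult_le_mono) auto
  finally have C: "card ?C \<le> 16 * 1000 ^ (m - i) * (v + 1)\<^sup>2" by simp
  have "finite ?C" using finD finite_comb by auto
  then have "hilbert m r ?d \<le> card ((low_z (comb_height m i) ?d \<union> pure_powers r ?d) \<union> ?C)"
    unfolding hilbert_def using divisors_subset[of i m v r] assms
    by (intro card_mono) (auto simp: finite_low_z pure_powers_def)
  also have "\<dots> \<le> card (low_z (comb_height m i) ?d \<union> pure_powers r ?d) + card ?C"
    by (rule card_Un_le)
  finally show ?thesis using C assms(2) by (simp add: card_low_z_Un_pure_powers)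
qed

section \<open>Comparison of peaks and valleys\<close>

text \<open>For \<open>b = 1000 ^ i\<close> and codegree \<open>4 * b\<close>, the error is at most
  \<open>16 * 1000 ^ (m - i) * (5 * b)\<^sup>2\<close>, and \<open>16 * 25 = 400\<close>.\<close>

lemma hilbert_valley_le:
  assumes "i \<le> m"
  shows "hilbert m r (socle_degree m - 4 * 1000 ^ i)
    \<le> card (low_z (comb_height m i) (socle_degree m - 4 * 1000 ^ i)) + (r - 3)
      + 400 * 1000 ^ m * 1000 ^ i"
proof -
  define b :: nat where "b = 1000 ^ i"
  have b: "b \<ge> 1" by (simp add: b_def)
  have "4 * b < socle_degree m"
    using power_le_strip_height[OF assms] b unfolding socle_degree_def b_def[symmetric] by simp
  note * = hilbert_le[OF assms this, of r]
  have "(4 * b + 1)\<^sup>2 \<le> (5 * b)\<^sup>2" using b by (intro power_mono) auto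
  then have "16 * 1000 ^ (m - i) * (4 * b + 1)\<^sup>2 \<le> 16 * 1000 ^ (m - i) * (5 * b)\<^sup>2"
    by (rule mult_le_mono2)
  also have "\<dots> = 400 * (1000 ^ (m - i) * b) * b" by (simp add: power2_eq_square)
  also have "1000 ^ (m - i) * b = 1000 ^ m"
    using assms by (simp add: b_def flip: power_add)
  finally show ?thesis using * unfolding b_def[symmetric] by linarith
qed

text \<open>From codegree \<open>2 * b\<close> to \<open>4 * b\<close> the strip loses more than
  \<open>2000 * T * b\<close> monomials, while the coarser combs account for at most
  \<open>400 * T * b\<close>.\<close>

lemma hilbert_peak_gt_valley:
  assumes "i \<le> m"
  shows "hilbert m r (socle_degree m - 4 * 1000 ^ i) < hilbert m r (socle_degree m - 2 * 1000 ^ i)"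
proof -
  define b :: nat where "b = 1000 ^ i"
  define T :: nat where "T = 1000 ^ m"
  have K: "strip_height m = 1000 * T" by (simp add: strip_height_def T_def)
  have bT: "1 \<le> b" "b \<le> T" using assms by (auto simp: b_def T_def)
  have e: "socle_degree m = 8000 * T" by (simp add: socle_degree_def K)
  have c: "comb_height m i = 1000 * T + b" by (simp add: comb_height_def K b_def)
  have shift: "8000 * T - 2 * b = (8000 * T - 4 * b) + 2 * b" using bT by simp
  have "card (low_z (comb_height m i) (8000 * T - 2 * b))
      = card (low_z (comb_height m i) (8000 * T - 4 * b)) + (comb_height m i + 1) * (2 * b)"
    unfolding shift using bT c by (intro card_low_z_add) simp
  moreover have "400 * T * b < (comb_height m i + 1) * (2 * b)"
    using bT by (simp add: c algebra_simps add_pos_nonneg)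
  moreover have "hilbert m r (8000 * T - 4 * b)
      \<le> card (low_z (comb_height m i) (8000 * T - 4 * b)) + (r - 3) + 400 * T * b"
    using hilbert_valley_le[OF assms, of r] by (simp add: e b_def T_def)
  moreover have "card (low_z (comb_height m i) (8000 * T - 2 * b)) + (r - 3)
      \<le> hilbert m r (8000 * T - 2 * b)"
    using hilbert_ge[of i m "2 * b" r] assms bT unfolding e b_def[symmetric] by simp
  ultimately show ?thesis unfolding e b_def[symmetric] by linarith
qed

text \<open>From codegree \<open>4 * b\<close> to \<open>2000 * b\<close> the old strip loses about
  \<open>2 * 10^6 * T * b\<close> monomials, but the merging of the next comb adds
  \<open>999 * b\<close> rows of at least \<open>6000 * T\<close> each.\<close>

lemma hilbert_next_peak_gt_valley:
  assumes "Suc i \<le> m"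
  shows "hilbert m r (socle_degree m - 4 * 1000 ^ i) < hilbert m r (socle_degree m - 2 * 1000 ^ Suc i)"
proof -
  define b :: nat where "b = 1000 ^ i"
  define T :: nat where "T = 1000 ^ m"
  have K: "strip_height m = 1000 * T" by (simp add: strip_height_def T_def)
  have "1000 ^ Suc i \<le> T" unfolding T_def using assms by (intro power_increasing) auto
  then have bT: "1 \<le> b" "1000 * b \<le> T" by (auto simp: b_def)
  have e: "socle_degree m = 8000 * T" by (simp add: socle_degree_def K)
  define c where "c = 1000 * T + b"
  define c' where "c' = 1000 * T + 1000 * b"
  have c: "comb_height m i = c" "comb_height m (Suc i) = c'"
    by (simp_all add: comb_height_def K b_def c_def c'_def)
  have shift: "8000 * T - 4 * b = (8000 * T - 2000 * b) + 1996 * b" using bT by simp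
  have "card (low_z c (8000 * T - 4 * b)) = card (low_z c (8000 * T - 2000 * b)) + (c + 1) * (1996 * b)"
    unfolding shift using bT by (intro card_low_z_add) (simp add: c_def)
  moreover have "card (low_z c (8000 * T - 2000 * b)) + (c' - c) * (8000 * T - 2000 * b - c')
      \<le> card (low_z c' (8000 * T - 2000 * b))"
    using bT by (intro card_low_z_mono) (simp_all add: c_def c'_def)
  moreover have "(c + 1) * (1996 * b) + 400 * T * b < (c' - c) * (8000 * T - 2000 * b - c')"
  proof -
    \<comment> \<open>\<open>c + 1 = 1000 * T + b + 1\<close> with \<open>b\<close> and 1 at most
      \<open>T\<close>; then \<open>1002 * 1996 + 400 = 2000392\<close>.\<close>
    have "(c + 1) * (1996 * b) \<le> (1002 * T) * (1996 * b)"
      using bT by (intro mult_le_mono) (auto simp: c_def)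
    then have "(c + 1) * (1996 * b) + 400 * T * b \<le> 2000392 * (T * b)" by simp
    also have "\<dots> < (999 * b) * (6000 * T)" using bT by simp
    \<comment> \<open>The row length is \<open>7000 * T - 3000 * b\<close>, and
      \<open>1000 * b \<le> T\<close>.\<close>
    also have "\<dots> \<le> (c' - c) * (8000 * T - 2000 * b - c')"
      using bT by (intro mult_le_mono) (auto simp: c_def c'_def)
    finally show ?thesis .
  qed
  moreover have "hilbert m r (8000 * T - 4 * b)
      \<le> card (low_z c (8000 * T - 4 * b)) + (r - 3) + 400 * T * b"
    using hilbert_valley_le[of i m r] assms by (simp add: e b_def T_def c)
  moreover have "card (low_z c' (8000 * T - 2000 * b)) + (r - 3) \<le> hilbert m r (8000 * T - 2000 * b)"
    using hilbert_ge[of "Suc i" m "2000 * b" r] assms bT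
    unfolding e c power_Suc b_def[symmetric] by simp
  moreover have "2 * 1000 ^ Suc i = 2000 * b" by (simp add: b_def)
  ultimately show ?thesis unfolding e b_def[symmetric] by simp
qed

section \<open>Number of maxima and codimension\<close>

text \<open>Valleys sit in codegrees \<open>4 * 1000 ^ i\<close> for \<open>i \<le> m\<close>, and
  between consecutive ones lies the peak in codegree \<open>2 * 1000 ^ Suc i\<close>. Comb 0
  supplies only the valley of highest degree.\<close>

lemma card_maxima_hilbert_ge:
  "m \<le> card (maxima (map (hilbert m r) [0..<Suc (socle_degree m)]))"
proof (rule card_maxima_ge)
  fix i assume "i < m"
  have "1000 * 1000 ^ Suc i \<le> strip_height m"
    using \<open>i < m\<close> by (intro power_le_strip_height) simp
  moreover have "(1::nat) \<le> 1000 ^ i" by simp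
  ultimately have "socle_degree m - 4 * 1000 ^ Suc i < socle_degree m - 2 * 1000 ^ Suc i \<and>
      socle_degree m - 2 * 1000 ^ Suc i < socle_degree m - 4 * 1000 ^ i"
    unfolding socle_degree_def power_Suc by linarith
  then show "socle_degree m - 4 * 1000 ^ Suc i < socle_degree m - 2 * 1000 ^ Suc i \<and>
      socle_degree m - 2 * 1000 ^ Suc i < socle_degree m - 4 * 1000 ^ i \<and>
      hilbert m r (socle_degree m - 4 * 1000 ^ i) < hilbert m r (socle_degree m - 2 * 1000 ^ Suc i) \<and>
      hilbert m r (socle_degree m - 4 * 1000 ^ Suc i) < hilbert m r (socle_degree m - 2 * 1000 ^ Suc i)"
    using hilbert_next_peak_gt_valley[of i m r] hilbert_peak_gt_valley[of "Suc i" m r] \<open>i < m\<close>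
    by simp
qed simp

text \<open>The variables x, y, z occur in the strip, whose height and degree are positive; the
  others enter through the pure powers.\<close>

lemma hilbert_1:
  assumes "r \<ge> 3"
  shows "hilbert m r 1 = r"
proof -
  have e: "socle_degree m \<ge> 1" and K: "strip_height m \<ge> 1"
    by (auto simp: socle_degree_def strip_height_def)
  have "{x \<in> divisors_of (generators m r). size x = 1} = (\<lambda>k. {#k#}) ` {..<r}"
  proof (intro equalityI subsetI)
    fix x assume "x \<in> {x \<in> divisors_of (generators m r). size x = 1}"
    then obtain g where g: "g \<in> generators m r" "x \<subseteq># g" and "size x = 1"
      unfolding divisors_of_def by blast
    then obtain k where x: "x = {#k#}" using size_1_singleton_mset by blast
    have "k \<in># g" using g(2) x by simp
    moreover have "set_mset (mono3 p q l) \<subseteq> {..<r}" for p q l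
      using assms by (auto simp: mono3_def split: if_splits)
    ultimately have "k < r"
      using g(1) unfolding generators_def low_z_def comb_def tooth_def pure_powers_def
      by (fastforce split: if_splits)
    then show "x \<in> (\<lambda>k. {#k#}) ` {..<r}" using x by blast
  next
    fix x assume "x \<in> (\<lambda>k. {#k#}) ` {..<r}"
    then obtain k where x: "x = {#k#}" and k: "k < r" by auto
    have low: "mono3 p q l \<in> divisors_of (generators m r)" if "p + q + l = 1" for p q l
    proof -
      have "mono3 p (q + (socle_degree m - 1)) l \<in> generators m r"
        using that e K unfolding generators_def low_z_def by auto
      moreover have "mono3 p q l \<subseteq># mono3 p (q + (socle_degree m - 1)) l" by simp
      ultimately show ?thesis unfolding divisors_of_def by blast
    qed
    have "x \<in> divisors_of (generators m r)"
    proof (cases "k < 3")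
      case True
      then consider "k = 0" | "k = 1" | "k = 2" by linarith
      then show ?thesis
        using low[of 1 0 0] low[of 0 1 0] low[of 0 0 1] x by cases (auto simp: mono3_def)
    next
      case False
      then have "x \<in> pure_powers r 1" using x k by (auto simp: pure_powers_def)
      then show ?thesis using pure_powers_subset_divisors[OF e] by blast
    qed
    then show "x \<in> {x \<in> divisors_of (generators m r). size x = 1}" using x by simp
  qed
  moreover have "card ((\<lambda>k::nat. {#k#}) ` {..<r}) = r" by (subst card_image) (auto simp: inj_on_def)
  ultimately show ?thesis unfolding hilbert_def by simp
qed

theorem theorem3p9:
  fixes M r :: nat
  assumes "M \<ge> 2" and "r \<ge> 3"
  shows "\<exists>h. pure_O_sequence h \<and> \<not> unimodal h \<and> codimension h = r \<and> card (maxima h) = M"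
proof -
  \<comment> \<open>The parameter \<open>m = M\<close> already gives at least \<open>M\<close>
    maxima; a truncation has exactly \<open>M\<close>.\<close>
  have "\<exists>k\<le>Suc (socle_degree M). card (maxima (map (hilbert M r) [0..<k])) = M"
    using assms by (intro exact_card_maxima card_maxima_hilbert_ge) simp
  then obtain k where k: "k \<le> Suc (socle_degree M)"
    and card: "card (maxima (map (hilbert M r) [0..<k])) = M" by blast
  let ?h = "map (hilbert M r) [0..<k]"
  have uni: "\<not> unimodal ?h" using unimodal_imp_card_maxima_le_1[of ?h] card assms by auto
  \<comment> \<open>The truncation must keep the entry of index 1 for the codimension to be
    \<open>r\<close>.\<close>
  have "k > 1"
  proof (rule ccontr)
    assume "\<not> k > 1"
    then have "maxima ?h \<subseteq> {(0, 0)}" using maximaD(1,2)[of _ _ ?h] by fastforce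
    then have "card (maxima ?h) \<le> 1" using card_mono[of "{(0, 0)}" "maxima ?h"] by simp
    then show False using card assms by simp
  qed
  then obtain n where n: "k = Suc n" "n \<ge> 1" by (cases k) auto
  have "generators M r \<noteq> {}"
  proof -
    have "mono3 (socle_degree M) 0 0 \<in> generators M r"
      unfolding generators_def low_z_def by auto
    then show ?thesis by blast
  qed
  then have "pure_O_sequence (map (\<lambda>i. card {x \<in> divisors_of (generators M r). size x = i}) [0..<Suc n])"
    using k n by (intro pure_O_sequence_truncated[OF finite_generators _ size_generators]) auto
  then have "pure_O_sequence ?h" unfolding n hilbert_def[abs_def] .
  moreover have "codimension ?h = r"
    using \<open>k > 1\<close> hilbert_1[OF assms(2)] by (simp add: codimension_def)
  ultimately show ?thesis using uni card by blast
qed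

end
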